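(* Let $\xi_1,\dots,\xi_k$ be a family of non-vanishing vectors in $\mathbb{R}^d$ satisfying: (i) no $d$ vectors out of this family are linearly dependent; (ii) the family does not belong to any half-space, i.e. there is no $\omega\in\mathbb{R}^d$ such that $(\omega,\xi_i)>0$ for all $i$. Let $f(\xi_1),\dots,f(\xi_k)$ be arbitrary real numbers. Then $$\min_{\gamma\in\mathbb{R}^d}\max_i\,[f(\xi_i)-(\xi_i,\gamma)]=\max_{I}\mathbf{E}_If(\xi),$$ where the maximum on the right is taken over all families $\{\xi_i\}_{i\in I}$, $I\subset\{1,\dots,k\}$, of size $|I|=d+1$ that themselves satisfy (ii) (i.e. such that the origin is contained in the interior of the convex hull of $\{\xi_i\}_{i\in I}$), and $\mathbf{E}_I$ denotes the expectation with respect to the unique risk-neutral probability law on $\{\xi_i\}_{i\in I}$.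
   Context: $(\cdot,\cdot)$ is the Euclidean inner product. A probability law $\{p_i\}_{i\in I}$ on a finite family $\{\xi_i\}_{i\in I}$ is risk-neutral if $\sum_{i\in I}p_i\xi_i=0$. If $|I|=d+1$ and the origin lies in the interior of the convex hull of $\{\xi_i\}_{i\in I}$, there is exactly one such law, and $\mathbf{E}_If(\xi)=\sum_{i\in I}p_if(\xi_i)$.
   Formalization: The family is assumed to have at least d vectors (k ≥ d); for k < d condition (i) is vacuous and the maximum on the right is over an empty set (e.g. d = 3, k = 2, ξ_2 = −ξ_1). *)

theory Defs
  imports "HOL-Probability.Probability"
begin

text \<open>
  A finite family of vectors is a function \<open>\<xi>\<close> on indices together with a finite index set.
  A family with a repeated vector is linearly dependent, so the library notion for sets
  has to be complemented by injectivity of the indexing.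
\<close>

definition independent_family :: "('i \<Rightarrow> 'a::real_vector) \<Rightarrow> 'i set \<Rightarrow> bool" where
  "independent_family \<xi> I \<longleftrightarrow> inj_on \<xi> I \<and> independent (\<xi> ` I)"

definition in_half_space :: "('i \<Rightarrow> 'a::real_inner) \<Rightarrow> 'i set \<Rightarrow> bool" where
  "in_half_space \<xi> I \<longleftrightarrow> (\<exists>\<omega>. \<forall>i\<in>I. inner \<omega> (\<xi> i) > 0)"

definition risk_neutral :: "('i \<Rightarrow> 'a::real_vector) \<Rightarrow> 'i set \<Rightarrow> 'i pmf \<Rightarrow> bool" where
  "risk_neutral \<xi> I p \<longleftrightarrow> set_pmf p \<subseteq> I \<and> (\<Sum>i\<in>I. pmf p i *\<^sub>R \<xi> i) = 0"

text \<open>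
  The law below is well defined for the families it is used for; see
  \<open>ex1_risk_neutral\<close> and \<open>admissible_iff\<close> at the end of this theory.
\<close>

definition risk_neutral_law :: "('i \<Rightarrow> 'a::real_vector) \<Rightarrow> 'i set \<Rightarrow> 'i pmf" where
  "risk_neutral_law \<xi> I = (THE p. risk_neutral \<xi> I p)"

definition risk_neutral_expectation ::
    "('i \<Rightarrow> 'a::real_vector) \<Rightarrow> ('i \<Rightarrow> real) \<Rightarrow> 'i set \<Rightarrow> real" where
  "risk_neutral_expectation \<xi> f I = (\<Sum>i\<in>I. pmf (risk_neutral_law \<xi> I) i * f i)"

definition admissible :: "('i \<Rightarrow> 'a::euclidean_space) \<Rightarrow> 'i set \<Rightarrow> 'i set set" where
  "admissible \<xi> K = {I. I \<subseteq> K \<and> card I = DIM('a) + 1 \<and> \<not> in_half_space \<xi> I}"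


lemma independent_family_iff:
  fixes \<xi> :: "'i \<Rightarrow> 'a::real_vector"
  assumes "finite I"
  shows "independent_family \<xi> I \<longleftrightarrow>
    (\<forall>c::'i \<Rightarrow> real. (\<Sum>i\<in>I. c i *\<^sub>R \<xi> i) = 0 \<longrightarrow> (\<forall>i\<in>I. c i = 0))"
proof
  assume L: "independent_family \<xi> I"
  then have inj: "inj_on \<xi> I" and ind: "independent (\<xi> ` I)"
    by (auto simp: independent_family_def)
  show "\<forall>c::'i \<Rightarrow> real. (\<Sum>i\<in>I. c i *\<^sub>R \<xi> i) = 0 \<longrightarrow> (\<forall>i\<in>I. c i = 0)"
  proof (intro allI impI ballI)
    fix c :: "'i \<Rightarrow> real" and j
    assume c: "(\<Sum>i\<in>I. c i *\<^sub>R \<xi> i) = 0" and j: "j \<in> I"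
    have "(\<Sum>v\<in>\<xi> ` I. c (the_inv_into I \<xi> v) *\<^sub>R v) = (\<Sum>i\<in>I. c i *\<^sub>R \<xi> i)"
      using inj by (simp add: sum.reindex the_inv_into_f_f)
    then have "c (the_inv_into I \<xi> (\<xi> j)) = 0"
      using independentD[OF ind, of "\<xi> ` I" "\<lambda>v. c (the_inv_into I \<xi> v)" "\<xi> j"] c j assms
      by auto
    then show "c j = 0" using inj j by (simp add: the_inv_into_f_f)
  qed
next
  assume R: "\<forall>c::'i \<Rightarrow> real. (\<Sum>i\<in>I. c i *\<^sub>R \<xi> i) = 0 \<longrightarrow> (\<forall>i\<in>I. c i = 0)"
  have inj: "inj_on \<xi> I"
  proof (rule inj_onI, rule ccontr)
    fix i j assume ij: "i \<in> I" "j \<in> I" "\<xi> i = \<xi> j" "i \<noteq> j"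
    define c :: "'i \<Rightarrow> real" where "c = (\<lambda>l. (if l = i then 1 else 0) - (if l = j then 1 else 0))"
    have "(\<Sum>l\<in>I. c l *\<^sub>R \<xi> l) = (\<Sum>l\<in>I. (if l = i then \<xi> l else 0) - (if l = j then \<xi> l else 0))"
      by (rule sum.cong) (auto simp: c_def)
    also have "\<dots> = 0" using assms ij by (simp add: sum_subtractf)
    finally have "c i = 0" using R ij by blast
    then show False using ij by (simp add: c_def)
  qed
  moreover have "independent (\<xi> ` I)"
  proof -
    have "u v = 0" if "(\<Sum>v\<in>\<xi> ` I. u v *\<^sub>R v) = 0" "v \<in> \<xi> ` I" for u :: "'a \<Rightarrow> real" and v
    proof -
      have "(\<Sum>i\<in>I. u (\<xi> i) *\<^sub>R \<xi> i) = 0"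
        using that(1) inj by (simp add: sum.reindex)
      then show ?thesis using R that(2) by fastforce
    qed
    then show ?thesis
      using assms by (auto simp: dependent_finite)
  qed
  ultimately show "independent_family \<xi> I" by (simp add: independent_family_def)
qed

lemma ex1_risk_neutral:
  fixes \<xi> :: "'i \<Rightarrow> 'a::euclidean_space"
  assumes I: "card I = DIM('a) + 1" and int0: "0 \<in> interior (convex hull (\<xi> ` I))"
  shows "\<exists>!p. risk_neutral \<xi> I p"
proof -
  have fin: "finite I" using I by (metis add_is_0 card.infinite one_neq_zero)
  have aff: "aff_dim (\<xi> ` I) = DIM('a)"
    using int0 aff_dim_convex_hull aff_dim_nonempty_interior by (metis empty_iff)
  then have "int DIM('a) \<le> int (card (\<xi> ` I)) - 1"
    using aff_dim_le_card[of "\<xi> ` I"] fin by simp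
  then have card: "card (\<xi> ` I) = card I"
    using I card_image_le[OF fin, of \<xi>] by linarith
  then have inj: "inj_on \<xi> I" using fin by (simp add: eq_card_imp_inj_on)
  have nad: "\<not> affine_dependent (\<xi> ` I)"
    using aff card I fin by (simp add: affine_independent_iff_card)
  have "0 \<in> convex hull (\<xi> ` I)" using int0 interior_subset by blast
  then obtain u where u: "\<And>x. x \<in> \<xi> ` I \<Longrightarrow> 0 \<le> u x" "sum u (\<xi> ` I) = 1"
    "(\<Sum>x\<in>\<xi> ` I. u x *\<^sub>R x) = 0"
    using fin by (auto simp: convex_hull_finite)
  define q where "q i = (if i \<in> I then u (\<xi> i) else 0)" for i
  have q0: "0 \<le> q i" for i using u(1) by (auto simp: q_def)
  have q1: "sum q I = 1" using u(2) inj by (simp add: sum.reindex q_def)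
  have qs: "(\<Sum>i\<in>I. q i *\<^sub>R \<xi> i) = 0" using u(3) inj by (simp add: sum.reindex q_def)
  have qn: "(\<integral>\<^sup>+i. ennreal (q i) \<partial>count_space UNIV) = 1"
  proof -
    have "(\<integral>\<^sup>+i. ennreal (q i) \<partial>count_space UNIV) = (\<Sum>i\<in>I. ennreal (q i))"
      using fin by (intro nn_integral_count_space') (auto simp: q_def)
    then show ?thesis using q1 q0 by (simp add: sum_ennreal)
  qed
  have pe: "pmf (embed_pmf q) i = q i" for i using q0 qn by (rule pmf_embed_pmf)
  have "risk_neutral \<xi> I (embed_pmf q)"
    unfolding risk_neutral_def using qs by (auto simp: pe set_pmf_eq q_def split: if_splits)
  moreover have "p = r" if p: "risk_neutral \<xi> I p" and r: "risk_neutral \<xi> I r" for p r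
  proof (rule pmf_eqI)
    fix i
    define c where "c = (\<lambda>v. pmf p (the_inv_into I \<xi> v) - pmf r (the_inv_into I \<xi> v))"
    have ce: "c (\<xi> i) = pmf p i - pmf r i" if "i \<in> I" for i
      using that inj by (simp add: c_def the_inv_into_f_f)
    have "sum c (\<xi> ` I) = (\<Sum>i\<in>I. pmf p i - pmf r i)"
      using inj by (simp add: sum.reindex ce)
    also have "\<dots> = 0"
      using p r fin by (simp add: sum_subtractf sum_pmf_eq_1 risk_neutral_def)
    finally have c0: "sum c (\<xi> ` I) = 0" .
    have "(\<Sum>v\<in>\<xi> ` I. c v *\<^sub>R v) = (\<Sum>i\<in>I. pmf p i *\<^sub>R \<xi> i - pmf r i *\<^sub>R \<xi> i)"
      using inj by (simp add: sum.reindex ce algebra_simps)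
    also have "\<dots> = 0" using p r by (simp add: sum_subtractf risk_neutral_def)
    finally have cz: "\<forall>v\<in>\<xi> ` I. c v = 0"
      using nad fin c0 by (auto simp: affine_dependent_explicit_finite)
    show "pmf p i = pmf r i"
    proof (cases "i \<in> I")
      case True
      then show ?thesis using cz ce by force
    next
      case False
      then have "i \<notin> set_pmf p" "i \<notin> set_pmf r" using p r by (auto simp: risk_neutral_def)
      then show ?thesis by (simp add: set_pmf_iff)
    qed
  qed
  ultimately show ?thesis by blast
qed

lemma not_in_half_space_iff_interior:
  fixes \<xi> :: "'i \<Rightarrow> 'a::euclidean_space"
  assumes I: "card I = DIM('a) + 1"
    and ind: "\<And>J. J \<subseteq> I \<Longrightarrow> card J = DIM('a) \<Longrightarrow> independent_family \<xi> J"
  shows "\<not> in_half_space \<xi> I \<longleftrightarrow> 0 \<in> interior (convex hull (\<xi> ` I))"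
proof
  have fin: "finite I" using I by (metis add_is_0 card.infinite one_neq_zero)
  {
    assume "0 \<in> interior (convex hull (\<xi> ` I))"
    then have "0 \<in> convex hull (\<xi> ` I)" using interior_subset by blast
    then show "\<not> in_half_space \<xi> I"
    proof (rule contrapos_pn)
      assume "in_half_space \<xi> I"
      then obtain \<omega> where \<omega>: "\<forall>i\<in>I. inner \<omega> (\<xi> i) > 0" by (auto simp: in_half_space_def)
      have "convex hull (\<xi> ` I) \<subseteq> {x. inner \<omega> x > 0}"
        using \<omega> by (intro hull_minimal convex_halfspace_gt) auto
      then show "0 \<notin> convex hull (\<xi> ` I)" by auto
    qed
  }
  assume nh: "\<not> in_half_space \<xi> I"
  have hull: "0 \<in> convex hull (\<xi> ` I)"
  proof (rule ccontr)
    assume "0 \<notin> convex hull (\<xi> ` I)"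
    then obtain a b where "0 < b" "\<forall>x\<in>convex hull (\<xi> ` I). inner a x > b"
      using separating_hyperplane_closed_0[of "convex hull (\<xi> ` I)"] fin
      by (auto simp: finite_imp_compact_convex_hull compact_imp_closed)
    then have "\<forall>i\<in>I. inner a (\<xi> i) > 0" by (meson hull_inc image_eqI less_trans)
    then show False using nh by (auto simp: in_half_space_def)
  qed
  obtain S where S: "S \<subseteq> I" "inj_on \<xi> S" "\<xi> ` I = \<xi> ` S"
    using subset_image_inj[of "\<xi> ` I" \<xi> I] by blast
  obtain w where w: "\<And>x. x \<in> \<xi> ` I \<Longrightarrow> 0 \<le> w x" "sum w (\<xi> ` I) = 1"
    "(\<Sum>x\<in>\<xi> ` I. w x *\<^sub>R x) = 0"
    using fin hull by (auto simp: convex_hull_finite)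
  define u where "u i = (if i \<in> S then w (\<xi> i) else 0)" for i
  have u0: "0 \<le> u i" for i using w(1) S(1) by (auto simp: u_def)
  have "sum u I = sum u S" using S(1) fin by (intro sum.mono_neutral_right) (auto simp: u_def)
  then have u1: "sum u I = 1" using w(2) S by (simp add: sum.reindex u_def)
  have "(\<Sum>i\<in>I. u i *\<^sub>R \<xi> i) = (\<Sum>i\<in>S. u i *\<^sub>R \<xi> i)"
    using S(1) fin by (intro sum.mono_neutral_right) (auto simp: u_def)
  then have us: "(\<Sum>i\<in>I. u i *\<^sub>R \<xi> i) = 0" using w(3) S by (simp add: sum.reindex u_def)
  have van: "\<forall>i\<in>I. c i = 0" if c: "(\<Sum>i\<in>I. c i *\<^sub>R \<xi> i) = 0" "j \<in> I" "c j = 0" for c j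
  proof -
    have "independent_family \<xi> (I - {j})" using that I fin by (intro ind) auto
    moreover have "(\<Sum>i\<in>I - {j}. c i *\<^sub>R \<xi> i) = 0"
      using c fin by (simp add: sum.remove[of I j])
    ultimately have "\<forall>i\<in>I - {j}. c i = 0"
      using fin by (simp add: independent_family_iff)
    then show ?thesis using c by auto
  qed
  have upos: "0 < u i" if "i \<in> I" for i
  proof (rule ccontr)
    assume "\<not> 0 < u i"
    then have "u i = 0" using u0[of i] by simp
    then have "\<forall>i\<in>I. u i = 0" using van[OF us that] by blast
    then show False using u1 by simp
  qed
  have aff: "\<forall>i\<in>I. c i = 0" if c: "(\<Sum>i\<in>I. c i *\<^sub>R \<xi> i) = 0" "sum c I = 0" for c
  proof -
    obtain j where j: "j \<in> I" using I fin by fastforce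
    define t where "t = c j / u j"
    have "(\<Sum>i\<in>I. (c i - t * u i) *\<^sub>R \<xi> i)
        = (\<Sum>i\<in>I. c i *\<^sub>R \<xi> i) - t *\<^sub>R (\<Sum>i\<in>I. u i *\<^sub>R \<xi> i)"
      by (simp add: scaleR_sum_right sum_subtractf algebra_simps)
    then have "(\<Sum>i\<in>I. (c i - t * u i) *\<^sub>R \<xi> i) = 0" using c us by simp
    moreover have "c j - t * u j = 0" using upos[OF j] by (simp add: t_def)
    ultimately have e: "\<forall>i\<in>I. c i - t * u i = 0"
      using van[of "\<lambda>i. c i - t * u i" j] j by blast
    have "sum c I = (\<Sum>i\<in>I. t * u i)" using e by (intro sum.cong) auto
    then have "t = 0" using c(2) u1 by (simp flip: sum_distrib_left)
    then show ?thesis using e by simp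
  qed
  have inj: "inj_on \<xi> I"
  proof (rule inj_onI, rule ccontr)
    fix i j assume ij: "i \<in> I" "j \<in> I" "\<xi> i = \<xi> j" "i \<noteq> j"
    define c :: "'i \<Rightarrow> real" where "c = (\<lambda>l. (if l = i then 1 else 0) - (if l = j then 1 else 0))"
    have "(\<Sum>l\<in>I. c l *\<^sub>R \<xi> l) = (\<Sum>l\<in>I. (if l = i then \<xi> l else 0) - (if l = j then \<xi> l else 0))"
      by (rule sum.cong) (auto simp: c_def)
    also have "\<dots> = 0" using fin ij by (simp add: sum_subtractf)
    finally have "(\<Sum>l\<in>I. c l *\<^sub>R \<xi> l) = 0" .
    moreover have "sum c I = 0" using fin ij by (simp add: c_def sum_subtractf)
    ultimately have "c i = 0" using aff ij by blast
    then show False using ij by (simp add: c_def)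
  qed
  have nad: "\<not> affine_dependent (\<xi> ` I)"
  proof
    assume "affine_dependent (\<xi> ` I)"
    then obtain U where U: "sum U (\<xi> ` I) = 0" "\<exists>v\<in>\<xi> ` I. U v \<noteq> 0"
      "(\<Sum>v\<in>\<xi> ` I. U v *\<^sub>R v) = 0"
      using fin by (auto simp: affine_dependent_explicit_finite)
    then have "\<forall>i\<in>I. U (\<xi> i) = 0"
      using aff[of "\<lambda>i. U (\<xi> i)"] inj by (simp add: sum.reindex)
    then show False using U(2) by blast
  qed
  have card: "card (\<xi> ` I) = DIM('a) + 1" using inj I by (simp add: card_image)
  have "\<forall>x\<in>\<xi> ` I. 0 < w x"
  proof
    fix x assume "x \<in> \<xi> ` I"
    then obtain i where i: "i \<in> S" "x = \<xi> i" using S(3) by auto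
    then show "0 < w x" using upos[of i] S(1) by (auto simp: u_def)
  qed
  then show "0 \<in> interior (convex hull (\<xi> ` I))"
    using w card by (auto simp: interior_convex_hull_explicit_minimal[OF nad])
qed

lemma admissible_iff:
  fixes \<xi> :: "'i \<Rightarrow> 'a::euclidean_space"
  assumes "\<And>J. J \<subseteq> K \<Longrightarrow> card J = DIM('a) \<Longrightarrow> independent_family \<xi> J"
  shows "I \<in> admissible \<xi> K \<longleftrightarrow>
    I \<subseteq> K \<and> card I = DIM('a) + 1 \<and> 0 \<in> interior (convex hull (\<xi> ` I))"
  using assms not_in_half_space_iff_interior[of I \<xi>] unfolding admissible_def by blast

end

theory Submission
  imports Defs
begin

text \<open>
  Write \<open>\<phi> \<gamma> = max\<^sub>i (f i - (\<xi> i, \<gamma>))\<close>. A risk-neutral law gives every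
  linear functional \<open>(\<xi>, \<gamma>)\<close> mean zero, so the expectation of \<open>f\<close> equals the expectation
  of the residual \<open>f - (\<xi>, \<gamma>)\<close> and is at most \<open>\<phi> \<gamma>\<close>, for every \<open>\<gamma>\<close>. This weak
  duality (\<open>risk_neutral_expectation_le\<close>) bounds all right-hand expectations by the minimum
  of \<open>\<phi>\<close>. What remains is an admissible \<open>I\<close> on which a minimiser \<open>\<gamma>\<close> makes the residual
  constantly equal to \<open>\<phi> \<gamma>\<close>, since there the bound is an equality.

  Both halves of this rest on \<open>ex_admissible_subset\<close>: in general position, any subfamily in no
  half-space contains an admissible simplex. Applied to the whole family, it puts a ball around
  the origin into the convex hull, so \<open>\<phi>\<close> grows linearly and attains its minimum
  (\<open>ex_minimiser_MAX_residual\<close>). Applied to the indices that attain the maximum at a minimiser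
  \<open>\<gamma>\<close>, it yields the required \<open>I\<close>; these indices lie in no half-space because a direction
  \<open>\<omega>\<close> with \<open>(\<omega>, \<xi> i) > 0\<close> for all of them would be a descent direction
  (\<open>active_set_not_in_half_space\<close>).
\<close>

lemma continuous_on_MAX:
  fixes g :: "'i \<Rightarrow> 'a::topological_space \<Rightarrow> real"
  assumes "finite K" "K \<noteq> {}" "\<And>i. i \<in> K \<Longrightarrow> continuous_on S (g i)"
  shows "continuous_on S (\<lambda>x. MAX i\<in>K. g i x)"
  using assms
proof (induction K rule: finite_ne_induct)
  case (insert i K)
  then have "continuous_on S (\<lambda>x. max (g i x) (MAX i\<in>K. g i x))"
    by (intro continuous_on_max) auto
  then show ?case using insert.hyps by simp
qed simp

text \<open>
  The convex hull is compact, so if it misses the origin, a hyperplane strictly separates the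
  two, and its normal vector exhibits a half-space.
\<close>

lemma zero_in_convex_hull_if_not_in_half_space:
  fixes \<xi> :: "'i \<Rightarrow> 'a::euclidean_space"
  assumes fin: "finite A" and nh: "\<not> in_half_space \<xi> A"
  shows "0 \<in> convex hull (\<xi> ` A)"
proof (rule ccontr)
  assume "0 \<notin> convex hull (\<xi> ` A)"
  then obtain a b where "0 < b" "\<forall>x\<in>convex hull (\<xi> ` A). inner a x > b"
    using separating_hyperplane_closed_0[of "convex hull (\<xi> ` A)"] fin
    by (auto simp: finite_imp_compact_convex_hull compact_imp_closed)
  then have "\<forall>i\<in>A. inner a (\<xi> i) > 0" by (meson hull_inc image_eqI less_trans)
  then show False using nh by (auto simp: in_half_space_def)
qed

lemma zero_notin_convex_hull_independent:
  assumes "finite S" "independent S"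
  shows "0 \<notin> convex hull S"
proof
  assume "0 \<in> convex hull S"
  then obtain u where u: "sum u S = 1" "(\<Sum>v\<in>S. u v *\<^sub>R v) = 0"
    using assms(1) by (auto simp: convex_hull_finite)
  then have "\<forall>v\<in>S. u v = 0"
    using independentD[OF assms(2) assms(1) order.refl u(2)] by blast
  then show False using u(1) by simp
qed

text \<open>
  By Caratheodory's theorem the origin is already a convex combination of at most \<open>d + 1\<close> of the
  vectors. It cannot be one of \<open>d\<close> or fewer: these extend to \<open>d\<close> vectors of the family, which
  are independent. It is for this extension that the family must have at least \<open>d\<close> members.
\<close>

lemma ex_admissible_subset:
  fixes \<xi> :: "'i \<Rightarrow> 'a::euclidean_space"
  assumes fin: "finite K" and card: "DIM('a) \<le> card K"
    and ind: "\<And>J. J \<subseteq> K \<Longrightarrow> card J = DIM('a) \<Longrightarrow> independent_family \<xi> J"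
    and A: "A \<subseteq> K" "\<not> in_half_space \<xi> A"
  shows "\<exists>I\<in>admissible \<xi> K. I \<subseteq> A"
proof -
  have finA: "finite A" using A fin finite_subset by blast
  then have "0 \<in> convex hull (\<xi> ` A)"
    using zero_in_convex_hull_if_not_in_half_space A by blast
  then obtain S where S: "finite S" "S \<subseteq> \<xi> ` A" "card S \<le> DIM('a) + 1" "0 \<in> convex hull S"
    using caratheodory[of "\<xi> ` A"] unfolding set_eq_iff mem_Collect_eq by meson
  obtain I where I: "I \<subseteq> A" "inj_on \<xi> I" "S = \<xi> ` I"
    using S(2) subset_image_inj[of S \<xi> A] by blast
  have cI: "card I \<le> DIM('a) + 1" using S(3) I by (simp add: card_image)
  have "card I = DIM('a) + 1"
  proof (rule ccontr)
    assume "card I \<noteq> DIM('a) + 1"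
    then have "card I \<le> DIM('a)" using cI by simp
    then obtain J where J: "I \<subseteq> J" "J \<subseteq> K" "card J = DIM('a)"
      using exists_subset_between[of I "DIM('a)" K] card fin A(1) I(1) by auto
    then have "independent (\<xi> ` J)" using ind[OF J(2,3)] by (simp add: independent_family_def)
    then have "independent S" by (rule independent_mono) (use J(1) I(3) in auto)
    then show False using zero_notin_convex_hull_independent S by blast
  qed
  moreover have "\<not> in_half_space \<xi> I"
  proof
    assume "in_half_space \<xi> I"
    then obtain \<omega> where \<omega>: "\<forall>i\<in>I. inner \<omega> (\<xi> i) > 0" by (auto simp: in_half_space_def)
    have "convex hull S \<subseteq> {x. inner \<omega> x > 0}"
      using \<omega> I(3) by (intro hull_minimal convex_halfspace_gt) auto
    then show False using S(4) by auto
  qed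
  ultimately show ?thesis using I(1) A(1) by (auto simp: admissible_def)
qed

text \<open>
  The point of the ball opposite to \<open>\<gamma>\<close> is a convex combination of the \<open>\<xi> i\<close>, so some
  \<open>\<xi> i\<close> lies at least as far in the direction \<open>- \<gamma>\<close>.
\<close>

lemma exists_inner_le_if_cball_subset_hull:
  fixes \<xi> :: "'i \<Rightarrow> 'a::euclidean_space"
  assumes "0 \<le> r" "cball 0 r \<subseteq> convex hull (\<xi> ` I)"
  shows "\<exists>i\<in>I. inner (\<xi> i) \<gamma> \<le> - r * norm \<gamma>"
proof (rule ccontr)
  assume "\<not> ?thesis"
  then have "convex hull (\<xi> ` I) \<subseteq> {x. inner \<gamma> x > - r * norm \<gamma>}"
    by (intro hull_minimal convex_halfspace_gt) (auto simp: inner_commute not_le)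
  moreover have "- r *\<^sub>R sgn \<gamma> \<in> cball 0 r" using assms(1) by (simp add: norm_sgn)
  ultimately have "inner \<gamma> (- r *\<^sub>R sgn \<gamma>) > - r * norm \<gamma>" using assms(2) by blast
  moreover have "inner \<gamma> (sgn \<gamma>) = norm \<gamma>"
    by (simp add: sgn_div_norm dot_square_norm power2_eq_square field_simps)
  ultimately show False by simp
qed

text \<open>
  With a ball of radius \<open>r\<close> inside the convex hull, the maximal residual is at least
  \<open>min f + r * norm \<gamma>\<close>. It therefore exceeds its value at the origin outside a large ball, and
  compactness gives a minimiser inside.
\<close>

lemma ex_minimiser_MAX_residual:
  fixes \<xi> :: "'i \<Rightarrow> 'a::euclidean_space"
  assumes fin: "finite K" and I: "I \<subseteq> K" and int0: "0 \<in> interior (convex hull (\<xi> ` I))"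
  shows "\<exists>\<gamma>. \<forall>\<delta>. (MAX i\<in>K. f i - inner (\<xi> i) \<gamma>) \<le> (MAX i\<in>K. f i - inner (\<xi> i) \<delta>)"
proof -
  define \<phi> where "\<phi> \<gamma> = (MAX i\<in>K. f i - inner (\<xi> i) \<gamma>)" for \<gamma>
  have ne: "K \<noteq> {}" using int0 interior_subset I by fastforce
  obtain r where r: "0 < r" "cball 0 r \<subseteq> convex hull (\<xi> ` I)"
    using int0 by (auto simp: mem_interior_cball)
  define m where "m = (MIN i\<in>K. f i)"
  have growth: "m + r * norm \<gamma> \<le> \<phi> \<gamma>" for \<gamma>
  proof -
    obtain i where i: "i \<in> I" "inner (\<xi> i) \<gamma> \<le> - r * norm \<gamma>"
      using exists_inner_le_if_cball_subset_hull[of r \<xi> I \<gamma>] r by auto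
    have "m \<le> f i" unfolding m_def using fin i(1) I by (intro Min_le) auto
    then have "m + r * norm \<gamma> \<le> f i - inner (\<xi> i) \<gamma>" using i(2) by simp
    also have "\<dots> \<le> \<phi> \<gamma>" unfolding \<phi>_def using fin i(1) I by (intro Max_ge) auto
    finally show ?thesis .
  qed
  \<comment> \<open>The radius at which the lower bound \<open>m + r * norm \<gamma>\<close> reaches \<open>\<phi> 0\<close>.\<close>
  define R where "R = (\<phi> 0 - m) / r"
  have "0 \<le> R" using growth[of 0] r(1) by (simp add: R_def)
  moreover have "continuous_on (cball 0 R) \<phi>"
    unfolding \<phi>_def using fin ne by (intro continuous_on_MAX continuous_intros) auto
  ultimately obtain \<gamma> where \<gamma>: "\<And>\<delta>. \<delta> \<in> cball 0 R \<Longrightarrow> \<phi> \<gamma> \<le> \<phi> \<delta>"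
    using continuous_attains_inf[of "cball 0 R" \<phi>] by (metis compact_cball cball_eq_empty not_less)
  have "\<phi> \<gamma> \<le> \<phi> \<delta>" for \<delta>
  proof (cases "\<delta> \<in> cball 0 R")
    case False
    then have "\<phi> 0 < m + r * norm \<delta>" using r(1) by (simp add: R_def field_simps)
    then have "\<phi> 0 \<le> \<phi> \<delta>" using growth[of \<delta>] by simp
    moreover have "\<phi> \<gamma> \<le> \<phi> 0" using \<gamma>[of 0] \<open>0 \<le> R\<close> by simp
    ultimately show ?thesis by simp
  qed (rule \<gamma>)
  then show ?thesis unfolding \<phi>_def by blast
qed

text \<open>
  If \<open>(\<omega>, \<xi> i) > 0\<close> at all active indices, a small step from \<open>\<gamma>\<close> along \<open>\<omega>\<close> lowers
  the active residuals below \<open>m\<close>. By continuity it keeps the finitely many inactive ones below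
  \<open>m\<close> too, which contradicts minimality.
\<close>

lemma active_set_not_in_half_space:
  fixes \<xi> :: "'i \<Rightarrow> 'a::real_inner"
  assumes fin: "finite K" and ne: "K \<noteq> {}"
    and max: "m = (MAX i\<in>K. f i - inner (\<xi> i) \<gamma>)"
    and min: "\<And>\<delta>. m \<le> (MAX i\<in>K. f i - inner (\<xi> i) \<delta>)"
  shows "\<not> in_half_space \<xi> {i\<in>K. f i - inner (\<xi> i) \<gamma> = m}"
proof
  assume "in_half_space \<xi> {i\<in>K. f i - inner (\<xi> i) \<gamma> = m}"
  then obtain \<omega> where \<omega>: "\<And>i. i \<in> K \<Longrightarrow> f i - inner (\<xi> i) \<gamma> = m \<Longrightarrow> inner \<omega> (\<xi> i) > 0"
    by (auto simp: in_half_space_def)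
  have "eventually (\<lambda>t. f i - inner (\<xi> i) (\<gamma> + t *\<^sub>R \<omega>) < m) (at_right 0)" if i: "i \<in> K" for i
  proof (cases "f i - inner (\<xi> i) \<gamma> = m")
    case True
    have "f i - inner (\<xi> i) (\<gamma> + t *\<^sub>R \<omega>) < m" if "0 < t" for t
      using mult_pos_pos[OF that \<omega>[OF i True]] True by (simp add: inner_add_right inner_commute)
    then show ?thesis by (simp add: eventually_at_filter)
  next
    case False
    moreover have "f i - inner (\<xi> i) \<gamma> \<le> m" unfolding max using fin i by (intro Max_ge) auto
    ultimately have "f i - inner (\<xi> i) (\<gamma> + 0 *\<^sub>R \<omega>) < m" by simp
    moreover have "((\<lambda>t. f i - inner (\<xi> i) (\<gamma> + t *\<^sub>R \<omega>)) \<longlongrightarrow>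
        f i - inner (\<xi> i) (\<gamma> + 0 *\<^sub>R \<omega>)) (at_right 0)"
      by (intro tendsto_intros)
    ultimately show ?thesis by (rule order_tendstoD(2)[rotated])
  qed
  then have "eventually (\<lambda>t. \<forall>i\<in>K. f i - inner (\<xi> i) (\<gamma> + t *\<^sub>R \<omega>) < m) (at_right 0)"
    using fin by (intro eventually_ball_finite) auto
  then obtain t where t: "\<forall>i\<in>K. f i - inner (\<xi> i) (\<gamma> + t *\<^sub>R \<omega>) < m"
    using eventually_happens'[OF trivial_limit_at_right_real] by blast
  then have "(MAX i\<in>K. f i - inner (\<xi> i) (\<gamma> + t *\<^sub>R \<omega>)) < m"
    using fin ne by (subst Max_less_iff) auto
  then show False using min[of "\<gamma> + t *\<^sub>R \<omega>"] by simp
qed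

lemma risk_neutral_law_risk_neutral:
  fixes \<xi> :: "'i \<Rightarrow> 'a::euclidean_space"
  assumes "card I = DIM('a) + 1" "0 \<in> interior (convex hull (\<xi> ` I))"
  shows "risk_neutral \<xi> I (risk_neutral_law \<xi> I)"
  unfolding risk_neutral_law_def using ex1_risk_neutral[OF assms] by (rule theI')

text \<open>
  The identity behind the duality: a linear functional has mean zero under a risk-neutral law.
\<close>

lemma risk_neutral_sum_residual:
  fixes \<xi> :: "'i \<Rightarrow> 'a::real_inner"
  assumes "risk_neutral \<xi> I p"
  shows "(\<Sum>i\<in>I. pmf p i * (f i - inner (\<xi> i) \<gamma>)) = (\<Sum>i\<in>I. pmf p i * f i)"
proof -
  have "(\<Sum>i\<in>I. pmf p i * inner (\<xi> i) \<gamma>) = inner (\<Sum>i\<in>I. pmf p i *\<^sub>R \<xi> i) \<gamma>"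
    by (simp add: inner_sum_left)
  also have "\<dots> = 0" using assms by (simp add: risk_neutral_def)
  finally show ?thesis by (simp add: right_diff_distrib sum_subtractf)
qed

lemma risk_neutral_expectation_le:
  fixes \<xi> :: "'i \<Rightarrow> 'a::euclidean_space"
  assumes I: "card I = DIM('a) + 1" "0 \<in> interior (convex hull (\<xi> ` I))"
    and le: "\<And>i. i \<in> I \<Longrightarrow> f i - inner (\<xi> i) \<gamma> \<le> m"
  shows "risk_neutral_expectation \<xi> f I \<le> m"
proof -
  define p where "p = risk_neutral_law \<xi> I"
  have p: "risk_neutral \<xi> I p" unfolding p_def using I by (rule risk_neutral_law_risk_neutral)
  have fin: "finite I" using I(1) by (metis add_is_0 card.infinite one_neq_zero)
  have "risk_neutral_expectation \<xi> f I = (\<Sum>i\<in>I. pmf p i * (f i - inner (\<xi> i) \<gamma>))"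
    unfolding risk_neutral_sum_residual[OF p] by (simp add: risk_neutral_expectation_def p_def)
  also have "\<dots> \<le> (\<Sum>i\<in>I. pmf p i * m)" using le by (intro sum_mono mult_left_mono) auto
  also have "\<dots> = m"
    using p fin by (simp add: risk_neutral_def sum_pmf_eq_1 flip: sum_distrib_right)
  finally show ?thesis .
qed

text \<open>
  The complementary slackness case of weak duality: the lower bound is weak duality for \<open>- f\<close>
  and \<open>- \<gamma>\<close>.
\<close>

lemma risk_neutral_expectation_eq:
  fixes \<xi> :: "'i \<Rightarrow> 'a::euclidean_space"
  assumes I: "card I = DIM('a) + 1" "0 \<in> interior (convex hull (\<xi> ` I))"
    and eq: "\<And>i. i \<in> I \<Longrightarrow> f i - inner (\<xi> i) \<gamma> = m"
  shows "risk_neutral_expectation \<xi> f I = m"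
proof (rule antisym)
  show "risk_neutral_expectation \<xi> f I \<le> m"
    using I eq by (intro risk_neutral_expectation_le[where \<gamma> = \<gamma>]) auto
  have "risk_neutral_expectation \<xi> (\<lambda>i. - f i) I \<le> - m"
    using I eq by (intro risk_neutral_expectation_le[where \<gamma> = "- \<gamma>"]) force+
  then show "m \<le> risk_neutral_expectation \<xi> f I"
    by (simp add: risk_neutral_expectation_def sum_negf)
qed

text \<open>
  Every notion involved is invariant under the choice of indices and coordinates, so the duality
  is proved for a finite family in any Euclidean space.
\<close>

theorem minimax_risk_neutral:
  fixes \<xi> :: "'i \<Rightarrow> 'a::euclidean_space"
  assumes fin: "finite K" and card: "DIM('a) \<le> card K"
    and ind: "\<And>J. J \<subseteq> K \<Longrightarrow> card J = DIM('a) \<Longrightarrow> independent_family \<xi> J"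
    and nh: "\<not> in_half_space \<xi> K"
  shows "admissible \<xi> K \<noteq> {} \<and>
    (\<exists>\<gamma>. is_arg_min (\<lambda>\<gamma>. MAX i\<in>K. f i - inner (\<xi> i) \<gamma>) (\<lambda>_. True) \<gamma> \<and>
      (MAX i\<in>K. f i - inner (\<xi> i) \<gamma>) = (MAX I\<in>admissible \<xi> K. risk_neutral_expectation \<xi> f I))"
proof -
  note adm = admissible_iff[of K \<xi>, OF ind]
  have ne: "K \<noteq> {}" using nh by (auto simp: in_half_space_def)
  have fin_adm: "finite (admissible \<xi> K)"
    by (rule finite_subset[of _ "Pow K"]) (use fin in \<open>auto simp: admissible_def\<close>)
  obtain I0 where I0: "I0 \<in> admissible \<xi> K"
    using ex_admissible_subset[where A = K, OF fin card ind order.refl nh] by auto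
  then obtain \<gamma> where min: "\<And>\<delta>. (MAX i\<in>K. f i - inner (\<xi> i) \<gamma>) \<le> (MAX i\<in>K. f i - inner (\<xi> i) \<delta>)"
    using ex_minimiser_MAX_residual[OF fin, of I0 \<xi> f] adm by blast
  define m where "m = (MAX i\<in>K. f i - inner (\<xi> i) \<gamma>)"
  have active: "\<not> in_half_space \<xi> {i\<in>K. f i - inner (\<xi> i) \<gamma> = m}"
    by (rule active_set_not_in_half_space[OF fin ne m_def]) (unfold m_def, rule min)
  obtain I where I: "I \<in> admissible \<xi> K" "I \<subseteq> {i\<in>K. f i - inner (\<xi> i) \<gamma> = m}"
    using ex_admissible_subset[OF fin card ind Collect_subset active] by auto
  have EI: "risk_neutral_expectation \<xi> f I = m"
    using I adm[of I] by (intro risk_neutral_expectation_eq[where \<gamma> = \<gamma>]) auto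
  have le: "risk_neutral_expectation \<xi> f J \<le> m" if J: "J \<in> admissible \<xi> K" for J
  proof (rule risk_neutral_expectation_le[where \<gamma> = \<gamma>])
    show "f i - inner (\<xi> i) \<gamma> \<le> m" if "i \<in> J" for i
      unfolding m_def using fin that J adm[of J] by (intro Max_ge) auto
  qed (use J adm[of J] in auto)
  have "(MAX J\<in>admissible \<xi> K. risk_neutral_expectation \<xi> f J) = m"
    using fin_adm I(1) le by (intro Max_eqI) (auto simp: EI[symmetric])
  moreover have "is_arg_min (\<lambda>\<gamma>. MAX i\<in>K. f i - inner (\<xi> i) \<gamma>) (\<lambda>_. True) \<gamma>"
    using min by (simp add: is_arg_min_def not_less)
  ultimately show ?thesis using I0 unfolding m_def by (metis (lifting) empty_iff)
qed

theorem theorem3p2: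
  fixes \<xi> :: "nat \<Rightarrow> real ^ 'd" and f :: "nat \<Rightarrow> real" and k :: nat
  assumes "CARD('d) \<le> k"
    and "\<forall>i\<in>{1..k}. \<xi> i \<noteq> 0"
    and "\<forall>J. J \<subseteq> {1..k} \<and> card J = CARD('d) \<longrightarrow> independent_family \<xi> J"
    and "\<not> in_half_space \<xi> {1..k}"
  shows "admissible \<xi> {1..k} \<noteq> {} \<and>
    (\<exists>\<gamma>. is_arg_min (\<lambda>\<gamma>. MAX i\<in>{1..k}. f i - inner (\<xi> i) \<gamma>) (\<lambda>_. True) \<gamma> \<and>
      (MAX i\<in>{1..k}. f i - inner (\<xi> i) \<gamma>)
        = (MAX I\<in>admissible \<xi> {1..k}. risk_neutral_expectation \<xi> f I))"
  using assms by (intro minimax_risk_neutral) auto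

end
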